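(* Let $\alpha\in\{S,G\}$ (state transfer or gate operation; in the gate case assume $\mathsf F_G>0$ for the nominal propagator $U$), and consider a perturbation of one of the matrices $B,C_1,\dots,C_M$ by $\delta S_\mu$ with $S_\mu$ skew-Hermitian. Let $b\ge 0$ be such that $\|\partial_\mu\Gamma^{(k)}\|_F=\|\mathsf g_\mu^{(k)}\|\le b$ for all time steps $k=1,\dots,\tau$. Then the magnitude of the differential sensitivity of the fidelity to this perturbation structure satisfies $$\left|\partial_\mu\tilde{\mathsf F}_\alpha\right|\le \gamma\,\|\mathbf Z\|_1\,b,$$ where $\mathbf Z\in\mathbb R^{\tau}$ is the vector with $k$th component $\mathsf Z_k=\|\mathsf z^{(k)}\|=\|(\mathsf p^{(k)})^T\mathsf D^{(k)}\|$ (Euclidean norm), and $\|\mathbf Z\|_1=\sum_{k=1}^{\tau}|\mathsf Z_k|$.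
   Context: Nominal system. Fix $N,M,\tau\in\mathbb N$, $h>0$, $t_f=\tau h$, $t_k=kh$. Let $B,C_1,\dots,C_M\in\mathbb C^{N\times N}$ be skew-Hermitian, $u_1,\dots,u_M:[0,t_f]\to\mathbb R$ continuous, and $A(t)=B+\sum_{m=1}^M u_m(t)C_m$. The step size is assumed to satisfy $\int_s^{s+h}\|A(t)\|\,dt<\pi$ for all $0\le s\le t_f-h$ (spectral norm). Write $A^{(k)}=A(kh)$ and $A^{(k-1/2)}=A(kh-h/2)$. For $k=1,\dots,\tau$ define $$\Gamma^{(k)}=\tfrac h6\left(A^{(k-1)}+4A^{(k-1/2)}+A^{(k)}\right)-\tfrac{h^2}{12}[A^{(k-1)},A^{(k)}],\qquad U^{(k,k-1)}=\exp(\Gamma^{(k)}).$$ For $0\le \tau_1<\tau_2\le\tau$ let $U^{(\tau_2,\tau_1)}=U^{(\tau_2,\tau_2-1)}\cdots U^{(\tau_1+1,\tau_1)}$ (later times to the left), $U^{(j,j)}=I$, and $U=U^{(\tau,0)}$ (the nominal approximate propagator). Fidelities. For unit vectors $|\psi_0\rangle,|\psi_f\rangle\in\mathbb C^N$, $\mathsf F_S[V]=|\langle\psi_f|V|\psi_0\rangle|^2$. For a target unitary $U_f\in U(N)$, $\mathsf F_G[V]=\frac1N|\mathrm{Tr}(U_f^\dagger V)|$. $\mathsf F_\alpha$ without argument means $\mathsf F_\alpha[U]$. Perturbation and sensitivity. For skew-Hermitian $S_\mu$ and $\delta\in\mathbb R$, the perturbed generator $\tilde A(t)$ is $A(t)$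 with $B$ replaced by $B+\delta S_0$ (case $\mu=0$), or with $C_\mu$ replaced by $C_\mu+\delta S_\mu$ (case $\mu\in\{1,\dots,M\}$). Let $\tilde\Gamma^{(k)}(\delta)$ and $\tilde U(\delta)$ be obtained from $\tilde A$ by the same formulas as $\Gamma^{(k)}$ and $U$. Set $\partial_\mu\Gamma^{(k)}=\frac{d}{d\delta}\tilde\Gamma^{(k)}(\delta)|_{\delta=0}\in\mathfrak u(N)$ and $\partial_\mu\tilde{\mathsf F}_\alpha=\frac{d}{d\delta}\mathsf F_\alpha[\tilde U(\delta)]|_{\delta=0}$. Here $\mathfrak u(N)$ is the real Lie algebra of skew-Hermitian $N\times N$ matrices. Further notation. In the state transfer case: $P^{(k)}=U^{(k-1,0)}|\psi_0\rangle\langle\psi_f|U^{(\tau,k-1)}$, $z^*=\langle\psi_0|U^\dagger|\psi_f\rangle$, $\gamma=2$. In the gate case: $P^{(k)}=U^{(k-1,0)}U_f^\dagger U^{(\tau,k-1)}$, $z^*=\mathrm{Tr}(U^\dagger U_f)$, $\gamma=1/(N^2\mathsf F_G)$. Let $\{\sigma_n\}_{n=1}^{N^2}$ be a basis of $\mathfrak u(N)$, orthonormal for the inner product $(X,Y)\mapsto\mathrm{Re}\,\mathrm{Tr}(XY^\dagger)$. Define: - $\mathsf p^{(k)}\in\mathbb R^{N^2}$ by $\mathsf p^{(k)}_n=\mathrm{Re}\,\mathrm{Tr}(P^{(k)}z^*\sigma_n^\dagger)$; - $\mathsf g^{(k)}_\mu\in\mathbb R^{N^2}$ by $\partial_\mu\Gamma^{(k)}=\sum_n(\mathsf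 g_\mu^{(k)})_n\sigma_n$; - $\mathsf D^{(k)}\in\mathbb R^{N^2\times N^2}$ by $\mathsf D^{(k)}_{mn}=\int_0^1\mathrm{Tr}\left(e^{-\Gamma^{(k)}s}\sigma_n e^{\Gamma^{(k)}s}\sigma_m^\dagger\right)ds$; - $\mathsf z^{(k)}=(\mathsf p^{(k)})^T\mathsf D^{(k)}$ (a row vector). $\|\cdot\|_F$ is the Frobenius norm and $\|\cdot\|$ on real vectors is the Euclidean norm. *)

theory Defs
  imports "HOL-Analysis.Analysis"
begin

section \<open>Complex matrices\<close>

type_synonym 'n cmat = "complex^'n^'n"

definition cadj :: "'n::finite cmat \<Rightarrow> 'n cmat" where
  "cadj X = (\<chi> i j. cnj (X $ j $ i))"

definition skew_hermitian :: "'n::finite cmat \<Rightarrow> bool" where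
  "skew_hermitian X \<longleftrightarrow> cadj X = - X"

definition unitary_mat :: "'n::finite cmat \<Rightarrow> bool" where
  "unitary_mat V \<longleftrightarrow> cadj V ** V = mat 1 \<and> V ** cadj V = mat 1"

definition commutator :: "'n::finite cmat \<Rightarrow> 'n cmat \<Rightarrow> 'n cmat" where
  "commutator X Y = X ** Y - Y ** X"

definition cscale :: "complex \<Rightarrow> 'n::finite cmat \<Rightarrow> 'n cmat" where
  "cscale c X = (\<chi> i j. c * X $ i $ j)"

definition braket :: "complex^'n::finite \<Rightarrow> complex^'n \<Rightarrow> complex" where
  "braket \<phi> \<psi> = (\<Sum>i\<in>UNIV. cnj (\<phi> $ i) * \<psi> $ i)"

definition ketbra :: "complex^'n::finite \<Rightarrow> complex^'n \<Rightarrow> 'n cmat" where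
  "ketbra \<phi> \<psi> = (\<chi> i j. \<phi> $ i * cnj (\<psi> $ j))"

text \<open>The exponential of the library needs a type of class real_normed_algebra_1, and the
  multiplication of the type of matrices is componentwise. Hence the power series is spelled out.\<close>

definition mexp :: "'n::finite cmat \<Rightarrow> 'n cmat" where
  "mexp X = (\<Sum>k. (1 / fact k) *\<^sub>R (((**) X) ^^ k) (mat 1))"

definition spectral_norm :: "'n::finite cmat \<Rightarrow> real" where
  "spectral_norm X = onorm ((*v) X)"

text \<open>The norm of the library on nested vectors is the square root of the sum of the squared
  moduli of all entries, that is, the Frobenius norm.\<close>

abbreviation frob_norm :: "'n::finite cmat \<Rightarrow> real" where
  "frob_norm X \<equiv> norm X"


section \<open>Bilinear control system and its approximate propagator\<close>

definition generator ::
  "'n::finite cmat \<Rightarrow> (nat \<Rightarrow> 'n cmat) \<Rightarrow> nat \<Rightarrow> (nat \<Rightarrow> real \<Rightarrow> real) \<Rightarrow> real \<Rightarrow> 'n cmat" where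
  "generator B C M u t = B + (\<Sum>m=1..M. u m t *\<^sub>R C m)"

definition perturbed_generator ::
  "'n::finite cmat \<Rightarrow> (nat \<Rightarrow> 'n cmat) \<Rightarrow> nat \<Rightarrow> (nat \<Rightarrow> real \<Rightarrow> real) \<Rightarrow> nat \<Rightarrow> 'n cmat \<Rightarrow>
    real \<Rightarrow> real \<Rightarrow> 'n cmat" where
  "perturbed_generator B C M u \<mu> S \<delta> =
    (if \<mu> = 0 then generator (B + \<delta> *\<^sub>R S) C M u
     else generator B (C(\<mu> := C \<mu> + \<delta> *\<^sub>R S)) M u)"

definition Gamma :: "(real \<Rightarrow> 'n::finite cmat) \<Rightarrow> real \<Rightarrow> nat \<Rightarrow> 'n cmat" where
  "Gamma A h k =
    (h / 6) *\<^sub>R (A ((real k - 1) * h) + 4 *\<^sub>R A (real k * h - h / 2) + A (real k * h))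
    - (h\<^sup>2 / 12) *\<^sub>R commutator (A ((real k - 1) * h)) (A (real k * h))"

primrec propagator_from :: "(real \<Rightarrow> 'n::finite cmat) \<Rightarrow> real \<Rightarrow> nat \<Rightarrow> nat \<Rightarrow> 'n cmat" where
  "propagator_from A h i 0 = mat 1"
| "propagator_from A h i (Suc d) = mexp (Gamma A h (i + Suc d)) ** propagator_from A h i d"

text \<open>The propagator from step i to step j, meaningful for i at most j.\<close>

definition propagator :: "(real \<Rightarrow> 'n::finite cmat) \<Rightarrow> real \<Rightarrow> nat \<Rightarrow> nat \<Rightarrow> 'n cmat" where
  "propagator A h j i = propagator_from A h i (j - i)"


section \<open>Fidelities and their differential sensitivity\<close>

datatype 'n objective =
    State_Transfer "complex^'n" "complex^'n"  \<comment> \<open>initial state, final state\<close>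
  | Gate "complex^'n^'n"                      \<comment> \<open>target unitary\<close>

fun fidelity :: "'n::finite objective \<Rightarrow> 'n cmat \<Rightarrow> real" where
  "fidelity (State_Transfer \<psi>0 \<psi>f) V = (cmod (braket \<psi>f (V *v \<psi>0)))\<^sup>2"
| "fidelity (Gate Uf) V = cmod (trace (cadj Uf ** V)) / real CARD('n)"

fun admissible :: "'n::finite objective \<Rightarrow> 'n cmat \<Rightarrow> bool" where
  "admissible (State_Transfer \<psi>0 \<psi>f) U \<longleftrightarrow> norm \<psi>0 = 1 \<and> norm \<psi>f = 1"
| "admissible (Gate Uf) U \<longleftrightarrow> unitary_mat Uf \<and> fidelity (Gate Uf) U > 0"

fun gamma_factor :: "'n::finite objective \<Rightarrow> 'n cmat \<Rightarrow> real" where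
  "gamma_factor (State_Transfer \<psi>0 \<psi>f) U = 2"
| "gamma_factor (Gate Uf) U = 1 / ((real CARD('n))\<^sup>2 * fidelity (Gate Uf) U)"

fun zstar :: "'n::finite objective \<Rightarrow> 'n cmat \<Rightarrow> complex" where
  "zstar (State_Transfer \<psi>0 \<psi>f) U = braket \<psi>0 (cadj U *v \<psi>f)"
| "zstar (Gate Uf) U = trace (cadj U ** Uf)"

fun Pmat :: "'n::finite objective \<Rightarrow> (real \<Rightarrow> 'n cmat) \<Rightarrow> real \<Rightarrow> nat \<Rightarrow> nat \<Rightarrow> 'n cmat" where
  "Pmat (State_Transfer \<psi>0 \<psi>f) A h \<tau> k =
    propagator A h (k - 1) 0 ** ketbra \<psi>0 \<psi>f ** propagator A h \<tau> (k - 1)"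
| "Pmat (Gate Uf) A h \<tau> k =
    propagator A h (k - 1) 0 ** cadj Uf ** propagator A h \<tau> (k - 1)"

text \<open>In the following two definitions the argument \<open>At\<close> is a one-parameter family of
  generators, with the perturbation strength as parameter.\<close>

definition dGamma :: "(real \<Rightarrow> real \<Rightarrow> 'n::finite cmat) \<Rightarrow> real \<Rightarrow> nat \<Rightarrow> 'n cmat" where
  "dGamma At h k = vector_derivative (\<lambda>\<delta>. Gamma (At \<delta>) h k) (at 0)"

definition perturbed_fidelity ::
  "'n::finite objective \<Rightarrow> (real \<Rightarrow> real \<Rightarrow> 'n cmat) \<Rightarrow> real \<Rightarrow> nat \<Rightarrow> real \<Rightarrow> real" where
  "perturbed_fidelity \<alpha> At h \<tau> \<delta> = fidelity \<alpha> (propagator (At \<delta>) h \<tau> 0)"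


section \<open>Coordinates with respect to a basis of the skew-Hermitian matrices\<close>

definition orthonormal_basis_u :: "('d::finite \<Rightarrow> 'n::finite cmat) \<Rightarrow> bool" where
  "orthonormal_basis_u \<sigma> \<longleftrightarrow>
    inj \<sigma> \<and> independent (range \<sigma>) \<and> span (range \<sigma>) = {X. skew_hermitian X} \<and>
    (\<forall>m n. Re (trace (\<sigma> m ** cadj (\<sigma> n))) = (if m = n then 1 else 0))"

definition coords :: "('d::finite \<Rightarrow> 'n::finite cmat) \<Rightarrow> 'n cmat \<Rightarrow> real^'d" where
  "coords \<sigma> X = (THE c. X = (\<Sum>n\<in>UNIV. (c $ n) *\<^sub>R \<sigma> n))"

definition pvec ::
  "('d::finite \<Rightarrow> 'n::finite cmat) \<Rightarrow> 'n objective \<Rightarrow> (real \<Rightarrow> 'n cmat) \<Rightarrow> real \<Rightarrow> nat \<Rightarrow> nat \<Rightarrow>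
    real^'d" where
  "pvec \<sigma> \<alpha> A h \<tau> k =
    (\<chi> n. Re (trace (cscale (zstar \<alpha> (propagator A h \<tau> 0)) (Pmat \<alpha> A h \<tau> k) ** cadj (\<sigma> n))))"

text \<open>For skew-Hermitian generators the conjugates of \<open>\<sigma> n\<close> by the exponentials are again
  skew-Hermitian, so the integral is real. Taking the real part only converts the type.\<close>

definition Dmat ::
  "('d::finite \<Rightarrow> 'n::finite cmat) \<Rightarrow> (real \<Rightarrow> 'n cmat) \<Rightarrow> real \<Rightarrow> nat \<Rightarrow> real^'d^'d" where
  "Dmat \<sigma> A h k =
    (\<chi> m n. Re (integral {0..1} (\<lambda>s.
      trace (mexp ((- s) *\<^sub>R Gamma A h k) ** \<sigma> n ** mexp (s *\<^sub>R Gamma A h k) ** cadj (\<sigma> m)))))"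

definition zvec ::
  "('d::finite \<Rightarrow> 'n::finite cmat) \<Rightarrow> 'n objective \<Rightarrow> (real \<Rightarrow> 'n cmat) \<Rightarrow> real \<Rightarrow> nat \<Rightarrow> nat \<Rightarrow>
    real^'d" where
  "zvec \<sigma> \<alpha> A h \<tau> k = pvec \<sigma> \<alpha> A h \<tau> k v* Dmat \<sigma> A h k"

definition Zcomp ::
  "('d::finite \<Rightarrow> 'n::finite cmat) \<Rightarrow> 'n objective \<Rightarrow> (real \<Rightarrow> 'n cmat) \<Rightarrow> real \<Rightarrow> nat \<Rightarrow> nat \<Rightarrow>
    real" where
  "Zcomp \<sigma> \<alpha> A h \<tau> k = norm (zvec \<sigma> \<alpha> A h \<tau> k)"

end

theory Submission
  imports Defs
begin

text \<open>Duhamel's identity \<open>e\<^sup>Y - e\<^sup>X = e\<^sup>X \<integral>\<^sub>0\<^sup>1 e\<^sup>-\<^sup>s\<^sup>X (Y - X) e\<^sup>s\<^sup>Y ds\<close> and a quadratic estimate of its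
  remainder give the derivative \<open>Z \<mapsto> e\<^sup>X \<integral>\<^sub>0\<^sup>1 e\<^sup>-\<^sup>s\<^sup>X Z e\<^sup>s\<^sup>X ds\<close> of the matrix exponential. By the
  product rule and cyclicity of the trace, the derivative of the fidelity is then \<open>\<gamma>\<close> times the sum over
  the steps of the pairing of \<open>z\<^sup>* P\<close> with the image of \<open>\<partial>\<Gamma>\<close> under this map. That map preserves the
  skew-Hermitian matrices, so expanding in the basis turns each pairing into \<open>-(p\<^sup>T D) g\<close>, and
  Cauchy-Schwarz applies.\<close>

section \<open>The matrix exponential and its derivative\<close>

lemma linear_matrix_mult_right: "linear (\<lambda>Y :: 'n::finite cmat. (X :: 'n cmat) ** Y)"
  by (rule linearI) (simp_all add: matrix_add_ldistrib matrix_scalar_ac scalar_matrix_assoc)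

lemma linear_matrix_mult_left: "linear (\<lambda>X :: 'n::finite cmat. X ** (Y :: 'n cmat))"
  by (rule linearI)
    (simp_all add: vec_eq_iff matrix_matrix_mult_def ring_distribs sum.distrib scaleR_sum_right)

lemma bounded_bilinear_matrix_mult:
  "bounded_bilinear (\<lambda>(X :: 'n::finite cmat) (Y :: 'n cmat). X ** Y)"
  unfolding bilinear_conv_bounded_bilinear[symmetric] bilinear_def
  by (simp add: linear_matrix_mult_left linear_matrix_mult_right)

interpretation mm: bounded_bilinear "\<lambda>(X :: 'n::finite cmat) (Y :: 'n cmat). X ** Y"
  by (rule bounded_bilinear_matrix_mult)

text \<open>Cauchy-Schwarz bounds each entry of the product; summing over row and column index
  separately makes the bound factor into the two Frobenius norms.\<close>

lemma norm_matrix_mult_le: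
  fixes X Y :: "'n::finite cmat"
  shows "norm (X ** Y) \<le> norm X * norm Y"
proof -
  have entry: "(cmod ((X ** Y) $ i $ j))\<^sup>2 \<le> (\<Sum>k\<in>UNIV. (cmod (X $ i $ k))\<^sup>2) * (\<Sum>k\<in>UNIV. (cmod (Y $ k $ j))\<^sup>2)" for i j
  proof -
    have "cmod ((X ** Y) $ i $ j) \<le> (\<Sum>k\<in>UNIV. \<bar>cmod (X $ i $ k)\<bar> * \<bar>cmod (Y $ k $ j)\<bar>)"
      unfolding matrix_matrix_mult_def by (simp add: norm_mult sum_norm_le)
    also have "\<dots> \<le> L2_set (\<lambda>k. cmod (X $ i $ k)) UNIV * L2_set (\<lambda>k. cmod (Y $ k $ j)) UNIV"
      by (rule L2_set_mult_ineq)
    finally have "(cmod ((X ** Y) $ i $ j))\<^sup>2 \<le> (L2_set (\<lambda>k. cmod (X $ i $ k)) UNIV * L2_set (\<lambda>k. cmod (Y $ k $ j)) UNIV)\<^sup>2"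
      by (rule power_mono) simp
    then show ?thesis
      by (simp add: L2_set_def power_mult_distrib sum_nonneg)
  qed
  have sq: "(norm Z)\<^sup>2 = (\<Sum>i\<in>UNIV. \<Sum>j\<in>UNIV. (cmod (Z $ i $ j))\<^sup>2)" for Z :: "'n cmat"
    by (simp add: norm_vec_def L2_set_def sum_nonneg)
  have "(norm (X ** Y))\<^sup>2 \<le> (\<Sum>i\<in>UNIV. \<Sum>j\<in>UNIV. (\<Sum>k\<in>UNIV. (cmod (X $ i $ k))\<^sup>2) * (\<Sum>k\<in>UNIV. (cmod (Y $ k $ j))\<^sup>2))"
    unfolding sq by (intro sum_mono entry)
  also have "\<dots> = (norm X)\<^sup>2 * (\<Sum>j\<in>UNIV. \<Sum>k\<in>UNIV. (cmod (Y $ k $ j))\<^sup>2)"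
    by (simp add: sq sum_product)
  also have "\<dots> = (norm X * norm Y)\<^sup>2"
    by (subst sum.swap) (simp add: sq power_mult_distrib)
  finally show ?thesis
    by (rule power2_le_imp_le) simp
qed

section \<open>Matrix powers and convergence of the exponential series\<close>

definition mpow :: "'n::finite cmat \<Rightarrow> nat \<Rightarrow> 'n cmat" where
  "mpow X k = (((**) X) ^^ k) (mat 1)"

lemma mpow_0 [simp]: "mpow X 0 = mat 1"
  and mpow_Suc: "mpow X (Suc k) = X ** mpow X k"
  by (simp_all add: mpow_def)

lemma mpow_Suc_right: "mpow X (Suc k) = mpow X k ** X"
  by (induction k) (simp_all add: mpow_Suc matrix_mul_assoc)

lemma mpow_scaleR: "mpow (t *\<^sub>R X) k = t ^ k *\<^sub>R mpow X k"
  by (induction k) (simp_all add: mpow_Suc mm.scaleR_left mm.scaleR_right mult.commute)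

text \<open>The identity has Frobenius norm \<open>sqrt N\<close>, so \<open>norm (mat 1)\<close>
  accompanies all later bounds on exponentials.\<close>

lemma norm_mpow_le: "norm (mpow X k) \<le> norm (mat 1 :: 'n::finite cmat) * norm (X :: 'n cmat) ^ k"
proof (induction k)
  case (Suc k)
  have "norm (mpow X (Suc k)) \<le> norm X * norm (mpow X k)"
    unfolding mpow_Suc by (rule norm_matrix_mult_le)
  also have "\<dots> \<le> norm X * (norm (mat 1 :: 'n cmat) * norm X ^ k)"
    by (intro mult_left_mono Suc) simp
  finally show ?case by (simp add: mult_ac)
qed simp

lemma mexp_eq_mpow: "mexp X = (\<Sum>k. (1 / fact k) *\<^sub>R mpow X k)"
  by (simp add: mexp_def mpow_def)

lemma norm_mexp_term_le:
  "norm ((1 / fact k) *\<^sub>R mpow X k) \<le> norm (mat 1 :: 'n::finite cmat) * (norm (X :: 'n cmat) ^ k /\<^sub>R fact k)"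
  using mult_left_mono[OF norm_mpow_le[of X k], of "inverse (fact k)"] by (simp add: divide_simps)

lemma summable_norm_mexp: "summable (\<lambda>k. norm ((1 / fact k) *\<^sub>R mpow X k))"
  by (rule summable_comparison_test'[where N = 0, OF summable_mult[OF summable_exp_generic[of "norm X"]]])
    (use norm_mexp_term_le in auto)

lemma summable_mexp: "summable (\<lambda>k. (1 / fact k) *\<^sub>R mpow X k)"
  by (rule summable_norm_cancel[OF summable_norm_mexp])

lemma norm_mexp_le: "norm (mexp (X :: 'n::finite cmat)) \<le> norm (mat 1 :: 'n cmat) * exp (norm X)"
proof -
  have "norm (mexp X) \<le> (\<Sum>k. norm ((1 / fact k) *\<^sub>R mpow X k))"
    unfolding mexp_eq_mpow by (rule summable_norm[OF summable_norm_mexp])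
  also have "\<dots> \<le> (\<Sum>k. norm (mat 1 :: 'n cmat) * (norm X ^ k /\<^sub>R fact k))"
    by (intro suminf_le norm_mexp_term_le summable_norm_mexp summable_mult summable_exp_generic)
  also have "\<dots> = norm (mat 1 :: 'n cmat) * exp (norm X)"
    unfolding exp_def by (rule suminf_mult[OF summable_exp_generic])
  finally show ?thesis .
qed

lemma mexp_0: "mexp (0 :: 'n::finite cmat) = mat 1"
proof -
  have "(1 / fact k) *\<^sub>R mpow 0 k = (if k = 0 then mat 1 else (0 :: 'n cmat))" for k
    by (cases k) (simp_all add: mpow_Suc mm.zero_left)
  then show ?thesis
    using sums_single[of 0 "\<lambda>_. mat 1 :: 'n cmat"]
    by (simp only: mexp_eq_mpow sums_iff)
qed

lemma mexp_commute: "X ** mexp (t *\<^sub>R X) = mexp (t *\<^sub>R X) ** X"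
proof -
  have "X ** mexp (t *\<^sub>R X) = (\<Sum>k. X ** ((1 / fact k) *\<^sub>R mpow (t *\<^sub>R X) k))"
    unfolding mexp_eq_mpow by (rule bounded_linear.suminf[OF mm.bounded_linear_right summable_mexp])
  also have "\<dots> = (\<Sum>k. ((1 / fact k) *\<^sub>R mpow (t *\<^sub>R X) k) ** X)"
    by (simp add: mpow_scaleR mm.scaleR_left mm.scaleR_right mpow_Suc[symmetric] mpow_Suc_right[symmetric])
  also have "\<dots> = mexp (t *\<^sub>R X) ** X"
    unfolding mexp_eq_mpow by (rule bounded_linear.suminf[OF mm.bounded_linear_left summable_mexp, symmetric])
  finally show ?thesis .
qed

text \<open>Power series are differentiated termwise as scalar functions, so matrix derivatives are
  assembled from entries by the linear embeddings \<open>E i j\<close>.\<close>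

lemma has_vector_derivative_cmat:
  fixes f :: "real \<Rightarrow> 'n::finite cmat"
  assumes "\<And>i j. ((\<lambda>t. f t $ i $ j) has_vector_derivative f' $ i $ j) F"
  shows "(f has_vector_derivative f') F"
proof -
  define E :: "'n \<Rightarrow> 'n \<Rightarrow> complex \<Rightarrow> 'n cmat" where "E i j c = axis i (axis j c)" for i j c
  have lin: "bounded_linear (E i j)" for i j
    unfolding linear_conv_bounded_linear[symmetric]
    by (rule linearI) (simp_all add: E_def vec_eq_iff axis_def)
  have expand: "X = (\<Sum>i\<in>UNIV. \<Sum>j\<in>UNIV. E i j (X $ i $ j))" for X :: "'n cmat"
  proof -
    have "E i j c $ a $ b = (if i = a then if j = b then c else 0 else 0)" for i j a b c
      by (simp add: E_def axis_def)
    moreover have "(\<Sum>j\<in>UNIV. if P then f j else 0) = (if P then sum f UNIV else 0)"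
      for P and f :: "'n \<Rightarrow> complex"
      by simp
    ultimately show ?thesis
      by (simp add: vec_eq_iff)
  qed
  have "((\<lambda>t. \<Sum>i\<in>UNIV. \<Sum>j\<in>UNIV. E i j (f t $ i $ j)) has_vector_derivative
      (\<Sum>i\<in>UNIV. \<Sum>j\<in>UNIV. E i j (f' $ i $ j))) F"
    by (intro has_vector_derivative_sum bounded_linear.has_vector_derivative[OF lin] assms)
  then show ?thesis
    by (simp only: expand[symmetric])
qed

text \<open>Along a line each entry of \<open>mexp\<close> is an everywhere convergent power series
  in the real parameter, so it may be differentiated termwise.\<close>

lemma mexp_scaleR_has_vector_derivative:
  fixes X :: "'n::finite cmat"
  shows "((\<lambda>t. mexp (t *\<^sub>R X)) has_vector_derivative X ** mexp (t *\<^sub>R X)) (at t within T)"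
proof (rule has_vector_derivative_cmat)
  fix i j
  define c where "c k = mpow X k $ i $ j / fact k" for k
  have lin: "bounded_linear (\<lambda>Z :: 'n cmat. Z $ i $ j)"
    by (rule bounded_linear_compose[OF bounded_linear_vec_nth bounded_linear_vec_nth])
  have summ: "summable (\<lambda>k. c k * z ^ k)" for z
  proof (rule summable_norm_cancel, rule summable_comparison_test'[where N = 0])
    show "summable (\<lambda>k. norm (mat 1 :: 'n cmat) * ((norm X * norm z) ^ k /\<^sub>R fact k))"
      by (intro summable_mult summable_exp_generic)
    show "norm (norm (c k * z ^ k)) \<le> norm (mat 1 :: 'n cmat) * ((norm X * norm z) ^ k /\<^sub>R fact k)" for k
    proof -
      have "cmod (mpow X k $ i $ j) \<le> norm (mat 1 :: 'n cmat) * norm X ^ k"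
        using Finite_Cartesian_Product.norm_nth_le norm_mpow_le order_trans by metis
      then have "cmod (mpow X k $ i $ j) * (norm z ^ k / fact k) \<le> norm (mat 1 :: 'n cmat) * norm X ^ k * (norm z ^ k / fact k)"
        by (rule mult_right_mono) simp
      then show ?thesis
        by (simp add: c_def norm_mult norm_divide norm_power power_mult_distrib field_simps)
    qed
  qed
  have entry: "mexp (r *\<^sub>R X) $ i $ j = (\<Sum>k. c k * of_real r ^ k)" for r
  proof -
    have "mexp (r *\<^sub>R X) $ i $ j = (\<Sum>k. ((1 / fact k) *\<^sub>R mpow (r *\<^sub>R X) k) $ i $ j)"
      unfolding mexp_eq_mpow by (rule bounded_linear.suminf[OF lin summable_mexp])
    also have "\<dots> = (\<Sum>k. c k * of_real r ^ k)"
      by (simp add: mpow_scaleR c_def scaleR_conv_of_real[where 'a = complex] mult_ac)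
    finally show ?thesis .
  qed
  \<comment> \<open>Multiplying by \<open>X\<close> raises the power by one, and
    \<open>(k + 1) / fact (k + 1) = 1 / fact k\<close> identifies the coefficients with those of the
    differentiated series.\<close>
  have "(X ** mexp (t *\<^sub>R X)) $ i $ j = (\<Sum>k. (X ** ((1 / fact k) *\<^sub>R mpow (t *\<^sub>R X) k)) $ i $ j)"
    unfolding mexp_eq_mpow
    by (rule bounded_linear.suminf[OF bounded_linear_compose[OF lin mm.bounded_linear_right] summable_mexp])
  also have "\<dots> = (\<Sum>k. diffs c k * of_real t ^ k)"
    by (simp add: diffs_def c_def mpow_scaleR mm.scaleR_right mpow_Suc[symmetric]
        scaleR_conv_of_real[where 'a = complex] mult_ac
        del: of_nat_Suc)
  finally have deriv: "(X ** mexp (t *\<^sub>R X)) $ i $ j = (\<Sum>k. diffs c k * of_real t ^ k)" .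
  have "((\<lambda>r. mexp (r *\<^sub>R X) $ i $ j) has_vector_derivative (X ** mexp (t *\<^sub>R X)) $ i $ j) (at t)"
    unfolding deriv entry
    by (rule has_vector_derivative_real_field[OF termdiffs_strong_converges_everywhere[OF summ]])
  then show "((\<lambda>r. mexp (r *\<^sub>R X) $ i $ j) has_vector_derivative (X ** mexp (t *\<^sub>R X)) $ i $ j) (at t within T)"
    by (rule has_vector_derivative_at_within)
qed

lemma continuous_on_mexp_scaleR: "continuous_on T (\<lambda>t. mexp (t *\<^sub>R X))"
  by (rule continuous_on_vector_derivative, rule mexp_scaleR_has_vector_derivative)

text \<open>With \<open>X\<close> on the right of the exponential, both terms of the product rule in
  \<open>mexp_prod_has_vector_derivative\<close> share their outer factors.\<close>

lemma mexp_minus_scaleR_has_vector_derivative: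
  fixes X :: "'n::finite cmat"
  shows "((\<lambda>t. mexp ((- t) *\<^sub>R X)) has_vector_derivative - (mexp ((- t) *\<^sub>R X) ** X)) (at t within T)"
  using mexp_scaleR_has_vector_derivative[of "- X" t T]
  by (simp add: mm.minus_left mexp_commute[of X "- t", simplified])

lemma continuous_on_mexp_minus_scaleR: "continuous_on T (\<lambda>t. mexp ((- t) *\<^sub>R X))"
  using continuous_on_mexp_scaleR[of T "- X"] by simp

lemma mexp_prod_has_vector_derivative:
  "((\<lambda>s. mexp ((- s) *\<^sub>R X) ** mexp (s *\<^sub>R Y)) has_vector_derivative
     mexp ((- s) *\<^sub>R X) ** (Y - X) ** mexp (s *\<^sub>R Y)) (at s within T)"
  using mm.has_vector_derivative[OF mexp_minus_scaleR_has_vector_derivative[of X s T]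
      mexp_scaleR_has_vector_derivative[of Y s T]]
  by (simp add: mm.diff_right mm.diff_left mm.minus_left matrix_mul_assoc)

text \<open>For \<open>Y = X\<close> the derivative in
  \<open>mexp_prod_has_vector_derivative\<close> vanishes, so the product keeps its value at
  0.\<close>

lemma mexp_minus_mult_mexp: "mexp ((- t) *\<^sub>R X) ** mexp (t *\<^sub>R X) = mat 1"
proof -
  obtain c where c: "\<And>s. mexp ((- s) *\<^sub>R X) ** mexp (s *\<^sub>R X) = c"
  proof (rule has_vector_derivative_zero_constant[of UNIV "\<lambda>s. mexp ((- s) *\<^sub>R X) ** mexp (s *\<^sub>R X)"])
    show "((\<lambda>s. mexp ((- s) *\<^sub>R X) ** mexp (s *\<^sub>R X)) has_vector_derivative 0) (at s within UNIV)" for s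
      using mexp_prod_has_vector_derivative[of X X s UNIV] by (simp only: diff_self mm.zero_left mm.zero_right)
  qed auto
  from c[of 0] have "c = mat 1" by (simp add: mexp_0)
  with c show ?thesis by simp
qed

lemma mexp_mult_mexp_minus: "mexp (t *\<^sub>R X) ** mexp ((- t) *\<^sub>R X) = mat 1"
  using mexp_minus_mult_mexp[of "- t" X] by simp

section \<open>Duhamel's identity and the Frechet derivative of the exponential\<close>

lemma continuous_on_conjugate:
  fixes X Y Z :: "'n::finite cmat"
  shows
  "continuous_on T (\<lambda>s. mexp ((- s) *\<^sub>R X) ** Z ** mexp (s *\<^sub>R Y))"
  by (intro mm.continuous_on continuous_on_const continuous_on_mexp_scaleR continuous_on_mexp_minus_scaleR)

text \<open>This is the fundamental theorem of calculus for the product in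
  \<open>mexp_prod_has_vector_derivative\<close>, multiplied on the left by
  \<open>mexp X\<close>.\<close>

lemma mexp_diff_eq_integral:
  "mexp Y - mexp X = mexp X ** integral {0..1} (\<lambda>s. mexp ((- s) *\<^sub>R X) ** (Y - X) ** mexp (s *\<^sub>R Y))"
proof -
  have "((\<lambda>s. mexp ((- s) *\<^sub>R X) ** (Y - X) ** mexp (s *\<^sub>R Y)) has_integral
      mexp ((- 1) *\<^sub>R X) ** mexp (1 *\<^sub>R Y) - mexp ((- 0) *\<^sub>R X) ** mexp (0 *\<^sub>R Y)) {0..1}"
    by (intro fundamental_theorem_of_calculus mexp_prod_has_vector_derivative) simp
  then have "integral {0..1} (\<lambda>s. mexp ((- s) *\<^sub>R X) ** (Y - X) ** mexp (s *\<^sub>R Y))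
      = mexp ((- 1) *\<^sub>R X) ** mexp Y - mat 1"
    by (simp add: integral_unique mexp_0)
  moreover have "mexp X ** mexp ((- 1) *\<^sub>R X) = mat 1"
    using mexp_mult_mexp_minus[of 1 X] by (simp only: scaleR_one)
  ultimately show ?thesis
    by (simp only: mm.diff_right[of _ _ "mat 1"] matrix_mul_assoc matrix_mul_lid matrix_mul_rid)
qed

text \<open>The derivative of the exponential at \<open>X\<close> in direction \<open>Z\<close>,
  with its left factor \<open>mexp X\<close> removed.\<close>

definition duhamel :: "'n::finite cmat \<Rightarrow> 'n cmat \<Rightarrow> 'n cmat" where
  "duhamel X Z = integral {0..1} (\<lambda>s. mexp ((- s) *\<^sub>R X) ** Z ** mexp (s *\<^sub>R X))"

lemma linear_duhamel: "linear (duhamel X)"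
proof (rule linearI)
  note int = integrable_continuous_real[OF continuous_on_conjugate]
  show "duhamel X (Y + Z) = duhamel X Y + duhamel X Z" for Y Z
    unfolding duhamel_def by (subst integral_add[OF int int, symmetric]) (simp add: mm.add_left mm.add_right)
  show "duhamel X (r *\<^sub>R Z) = r *\<^sub>R duhamel X Z" for r Z
    unfolding duhamel_def by (simp add: mm.scaleR_left mm.scaleR_right)
qed

lemma norm_mexp_scaleR_le:
  fixes X :: "'n::finite cmat"
  assumes "\<bar>s\<bar> \<le> 1" "norm X \<le> R"
  shows "norm (mexp (s *\<^sub>R X)) \<le> norm (mat 1 :: 'n cmat) * exp R"
proof -
  have "norm (s *\<^sub>R X) \<le> 1 * R"
    unfolding norm_scaleR using assms by (intro mult_mono) auto
  then show ?thesis
    by (intro order_trans[OF norm_mexp_le] mult_left_mono) auto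
qed

lemma norm_mexp_conjugate_le:
  fixes X Z V :: "'n::finite cmat"
  assumes "s \<in> {0..1}" "norm X \<le> R" 
  shows "norm (mexp ((- s) *\<^sub>R X) ** Z ** V) \<le> norm (mat 1 :: 'n cmat) * exp R * norm Z * norm V"
proof -
  have "norm (mexp ((- s) *\<^sub>R X) ** Z ** V) \<le> norm (mexp ((- s) *\<^sub>R X)) * norm Z * norm V"
    by (intro order_trans[OF norm_matrix_mult_le] mult_right_mono norm_matrix_mult_le) simp
  also have "\<dots> \<le> norm (mat 1 :: 'n cmat) * exp R * norm Z * norm V"
    using assms by (intro mult_right_mono norm_mexp_scaleR_le) auto
  finally show ?thesis .
qed

text \<open>In Duhamel's identity one factor of the constant comes from \<open>mexp X\<close> and
  one from each exponential under the integral, hence the cube.\<close>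

lemma norm_mexp_diff_le:
  fixes X Y :: "'n::finite cmat"
  assumes "norm X \<le> R" "norm Y \<le> R"
  shows "norm (mexp Y - mexp X) \<le> (norm (mat 1 :: 'n cmat) * exp R) ^ 3 * norm (Y - X)"
proof -
  define K where "K = norm (mat 1 :: 'n cmat) * exp R"
  have K: "0 \<le> K" by (simp add: K_def)
  have "norm (integral {0..1} (\<lambda>s. mexp ((- s) *\<^sub>R X) ** (Y - X) ** mexp (s *\<^sub>R Y))) \<le> K * norm (Y - X) * K * (1 - 0)"
  proof (rule integral_bound[OF _ continuous_on_conjugate])
    fix s :: real assume s: "s \<in> {0..1}"
    have "norm (mexp ((- s) *\<^sub>R X) ** (Y - X) ** mexp (s *\<^sub>R Y)) \<le> K * norm (Y - X) * norm (mexp (s *\<^sub>R Y))"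
      unfolding K_def by (rule norm_mexp_conjugate_le[OF s assms(1)])
    also have "\<dots> \<le> K * norm (Y - X) * K"
      using s assms K unfolding K_def by (intro mult_left_mono norm_mexp_scaleR_le) auto
    finally show "norm (mexp ((- s) *\<^sub>R X) ** (Y - X) ** mexp (s *\<^sub>R Y)) \<le> K * norm (Y - X) * K" .
  qed simp
  moreover have "norm (mexp X) \<le> K"
    using norm_mexp_scaleR_le[of 1 X R] assms by (simp add: K_def)
  ultimately have "norm (mexp Y - mexp X) \<le> K * (K * norm (Y - X) * K * (1 - 0))"
    unfolding mexp_diff_eq_integral[of Y X]
    by (intro order_trans[OF norm_matrix_mult_le] mult_mono K) auto
  then show ?thesis by (simp add: K_def power3_eq_cube mult_ac)
qed

text \<open>By Duhamel's identity the remainder is an integral whose last factor is the difference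
  of the exponentials of \<open>s Y\<close> and \<open>s X\<close>. That difference is of first
  order in \<open>Y - X\<close>, so the remainder is of second order.\<close>

lemma mexp_has_derivative:
  fixes X :: "'n::finite cmat"
  shows "(mexp has_derivative (\<lambda>Z. mexp X ** duhamel X Z)) (at X)"
proof -
  \<comment> \<open>The radius \<open>norm X + 1\<close> bounds \<open>norm X\<close> and also
    \<open>norm Y\<close> for every \<open>Y\<close> within distance 1 of \<open>X\<close>.\<close>
  define K where "K = norm (mat 1 :: 'n cmat) * exp (norm X + 1)"
  have K: "0 \<le> K" by (simp add: K_def)
  note int = integrable_continuous_real[OF continuous_on_conjugate]
  have remainder: "norm (mexp Y - mexp X - mexp X ** duhamel X (Y - X)) \<le> K ^ 5 * norm (Y - X) ^ 2"
    if "norm (Y - X) \<le> 1" for Y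
  proof -
    have Y: "norm Y \<le> norm X + 1"
      using norm_triangle_ineq2[of Y X] that by linarith
    have eq: "mexp Y - mexp X - mexp X ** duhamel X (Y - X) =
      mexp X ** integral {0..1} (\<lambda>s. mexp ((- s) *\<^sub>R X) ** (Y - X) ** (mexp (s *\<^sub>R Y) - mexp (s *\<^sub>R X)))"
      unfolding mexp_diff_eq_integral[of Y X] duhamel_def mm.diff_right[symmetric]
        Henstock_Kurzweil_Integration.integral_diff[OF int int, symmetric] by (rule refl)
    \<comment> \<open>One factor \<open>K\<close> comes from the left exponential and
      \<open>K ^ 3\<close> from the Lipschitz bound; the prefactor \<open>mexp X\<close> adds the
      fifth below.\<close>
    have "norm (integral {0..1} (\<lambda>s. mexp ((- s) *\<^sub>R X) ** (Y - X) ** (mexp (s *\<^sub>R Y) - mexp (s *\<^sub>R X))))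
      \<le> K ^ 4 * norm (Y - X) ^ 2 * (1 - 0)"
    proof (rule integral_bound)
      show "continuous_on {0..1} (\<lambda>s. mexp ((- s) *\<^sub>R X) ** (Y - X) ** (mexp (s *\<^sub>R Y) - mexp (s *\<^sub>R X)))"
        by (intro mm.continuous_on continuous_intros continuous_on_mexp_scaleR continuous_on_mexp_minus_scaleR)
      fix s :: real assume s: "s \<in> {0..1}"
      have le: "norm (s *\<^sub>R Z) \<le> norm Z" for Z :: "'n cmat"
        using s by (simp add: mult_left_le_one_le)
      have "norm (mexp (s *\<^sub>R Y) - mexp (s *\<^sub>R X)) \<le> K ^ 3 * norm (s *\<^sub>R Y - s *\<^sub>R X)"
        unfolding K_def using le[of X] le[of Y] Y by (intro norm_mexp_diff_le) linarith+
      also have "\<dots> \<le> K ^ 3 * norm (Y - X)"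
        using le[of "Y - X"] K by (intro mult_left_mono) (auto simp: scaleR_diff_right)
      finally have d: "norm (mexp (s *\<^sub>R Y) - mexp (s *\<^sub>R X)) \<le> K ^ 3 * norm (Y - X)" .
      have "norm (mexp ((- s) *\<^sub>R X) ** (Y - X) ** (mexp (s *\<^sub>R Y) - mexp (s *\<^sub>R X)))
         \<le> K * norm (Y - X) * norm (mexp (s *\<^sub>R Y) - mexp (s *\<^sub>R X))"
        unfolding K_def by (rule norm_mexp_conjugate_le[OF s]) simp
      also have "\<dots> \<le> K * norm (Y - X) * (K ^ 3 * norm (Y - X))"
        using d K by (intro mult_left_mono) auto
      finally show "norm (mexp ((- s) *\<^sub>R X) ** (Y - X) ** (mexp (s *\<^sub>R Y) - mexp (s *\<^sub>R X)))
         \<le> K ^ 4 * norm (Y - X) ^ 2"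
        by (simp add: power2_eq_square power3_eq_cube power4_eq_xxxx mult_ac)
    qed simp
    moreover have "norm (mexp X) \<le> K"
      using norm_mexp_scaleR_le[of 1 X "norm X + 1"] by (simp add: K_def)
    ultimately have "norm (mexp Y - mexp X - mexp X ** duhamel X (Y - X)) \<le> K * (K ^ 4 * norm (Y - X) ^ 2 * (1 - 0))"
      unfolding eq by (intro order_trans[OF norm_matrix_mult_le] mult_mono K) auto
    then show ?thesis by (simp add: power_numeral_reduce mult_ac)
  qed
  show ?thesis
  proof (rule has_derivativeI_sandwich[where e = 1 and H = "\<lambda>Y. K ^ 5 * norm (Y - X)"])
    show "bounded_linear (\<lambda>Z. mexp X ** duhamel X Z)"
      using linear_compose[OF linear_duhamel linear_matrix_mult_right]
      by (simp add: linear_conv_bounded_linear o_def)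
    show "((\<lambda>Y. K ^ 5 * norm (Y - X)) \<longlongrightarrow> 0) (at X)"
      by (auto intro!: tendsto_eq_intros)
    show "norm (mexp Y - mexp X - mexp X ** duhamel X (Y - X)) / norm (Y - X) \<le> K ^ 5 * norm (Y - X)"
      if "Y \<noteq> X" "dist Y X < 1" for Y
      using remainder[of Y] that by (simp add: dist_norm divide_simps power2_eq_square mult_ac)
  qed simp
qed

section \<open>Skew-Hermitian matrices and their coordinates\<close>

lemma linear_cadj: "linear cadj"
  by (rule linearI) (simp_all add: cadj_def vec_eq_iff)

lemma bounded_linear_cadj: "bounded_linear cadj"
  using linear_cadj by (simp add: linear_conv_bounded_linear)

lemma cadj_cadj [simp]: "cadj (cadj X) = X"
  by (simp add: cadj_def vec_eq_iff)

lemma cadj_mult: "cadj (X ** Y) = cadj Y ** cadj X"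
  by (simp add: cadj_def matrix_matrix_mult_def vec_eq_iff mult.commute)

lemma cadj_mat_1 [simp]: "cadj (mat 1) = mat 1"
  by (simp add: cadj_def mat_def vec_eq_iff)

lemma cadj_mexp: "cadj (mexp X) = mexp (cadj X)"
proof -
  \<comment> \<open>Adjoints reverse products, so a factor split off on the left reappears on the
    right.\<close>
  have mpow: "cadj (mpow X k) = mpow (cadj X) k" for k
    by (induction k) (simp, simp add: mpow_Suc[of X] mpow_Suc_right[of "cadj X"] cadj_mult)
  have "cadj (mexp X) = (\<Sum>k. cadj ((1 / fact k) *\<^sub>R mpow X k))"
    unfolding mexp_eq_mpow by (rule bounded_linear.suminf[OF bounded_linear_cadj summable_mexp])
  then show ?thesis
    by (simp only: mexp_eq_mpow linear_cmul[OF linear_cadj] mpow)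
qed

lemma skew_hermitian_add: "skew_hermitian X \<Longrightarrow> skew_hermitian Y \<Longrightarrow> skew_hermitian (X + Y)"
  by (simp add: skew_hermitian_def linear_add[OF linear_cadj])

lemma skew_hermitian_diff: "skew_hermitian X \<Longrightarrow> skew_hermitian Y \<Longrightarrow> skew_hermitian (X - Y)"
  by (simp add: skew_hermitian_def linear_diff[OF linear_cadj])

lemma skew_hermitian_scaleR: "skew_hermitian X \<Longrightarrow> skew_hermitian (r *\<^sub>R X)"
  by (simp add: skew_hermitian_def linear_cmul[OF linear_cadj])

lemma skew_hermitian_sum: "(\<And>i. i \<in> I \<Longrightarrow> skew_hermitian (f i)) \<Longrightarrow> skew_hermitian (sum f I)"
  by (simp add: skew_hermitian_def linear_sum[OF linear_cadj] sum_negf)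

lemma skew_hermitian_commutator:
  "skew_hermitian X \<Longrightarrow> skew_hermitian Y \<Longrightarrow> skew_hermitian (commutator X Y)"
  by (simp add: skew_hermitian_def commutator_def linear_diff[OF linear_cadj] cadj_mult
      mm.minus_left mm.minus_right)

lemmas skew_hermitian_intros =
  skew_hermitian_add skew_hermitian_diff skew_hermitian_scaleR skew_hermitian_sum skew_hermitian_commutator

text \<open>The adjoint of the exponential of \<open>s X\<close> is that of \<open>- s X\<close>.
  Taking adjoints therefore restores the conjugation and only turns \<open>Z\<close> into
  \<open>- Z\<close>.\<close>

lemma skew_hermitian_duhamel:
  assumes X: "skew_hermitian X" and Z: "skew_hermitian Z"
  shows "skew_hermitian (duhamel X Z)"
proof -
  have conj: "cadj (mexp ((- s) *\<^sub>R X) ** Z ** mexp (s *\<^sub>R X)) = - (mexp ((- s) *\<^sub>R X) ** Z ** mexp (s *\<^sub>R X))" for s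
  proof -
    have "cadj (r *\<^sub>R X) = (- r) *\<^sub>R X" for r
      using X by (simp add: skew_hermitian_def linear_cmul[OF linear_cadj])
    then have "cadj (mexp (r *\<^sub>R X)) = mexp ((- r) *\<^sub>R X)" for r
      by (simp only: cadj_mexp)
    from this[of s] this[of "- s"] Z show ?thesis
      by (simp add: cadj_mult skew_hermitian_def mm.minus_left mm.minus_right matrix_mul_assoc)
  qed
  have "cadj (duhamel X Z) = integral {0..1} (cadj \<circ> (\<lambda>s. mexp ((- s) *\<^sub>R X) ** Z ** mexp (s *\<^sub>R X)))"
    unfolding duhamel_def
    by (rule integral_linear[OF integrable_continuous_real[OF continuous_on_conjugate] bounded_linear_cadj, symmetric])
  also have "\<dots> = - duhamel X Z"
    unfolding duhamel_def o_def conj by (rule integral_neg)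
  finally show ?thesis by (simp add: skew_hermitian_def)
qed

text \<open>Identifies the trace product of the problem with the inner product of nested vectors, so
  orthonormality and Cauchy-Schwarz refer to the usual Euclidean structure.\<close>

lemma inner_cmat: "X \<bullet> Y = Re (trace (X ** cadj Y))"
  by (simp add: inner_vec_def inner_complex_def trace_def matrix_matrix_mult_def cadj_def)

lemma basis_inner: "orthonormal_basis_u \<sigma> \<Longrightarrow> \<sigma> m \<bullet> \<sigma> n = (if m = n then 1 else 0)"
  by (simp add: orthonormal_basis_u_def inner_cmat)

lemma basis_inner_sum:
  assumes "orthonormal_basis_u \<sigma>"
  shows "(\<Sum>n\<in>UNIV. c n *\<^sub>R \<sigma> n) \<bullet> \<sigma> m = c m"
  by (simp add: inner_sum_left basis_inner[OF assms] if_distrib[of "(*) _"] cong: if_cong)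

text \<open>Some expansion exists because the basis spans; orthonormality then identifies its
  coefficients.\<close>

lemma skew_hermitian_expansion:
  assumes \<sigma>: "orthonormal_basis_u \<sigma>" and X: "skew_hermitian X"
  shows "X = (\<Sum>n\<in>UNIV. (X \<bullet> \<sigma> n) *\<^sub>R \<sigma> n)"
proof -
  have "X \<in> span (range \<sigma>)" "inj \<sigma>"
    using \<sigma> X by (auto simp: orthonormal_basis_u_def)
  then obtain c where "X = (\<Sum>v\<in>range \<sigma>. c v *\<^sub>R v)"
    by (auto simp: span_finite)
  then have eq: "X = (\<Sum>n\<in>UNIV. c (\<sigma> n) *\<^sub>R \<sigma> n)"
    using \<open>inj \<sigma>\<close> by (simp add: sum.reindex)
  have "X \<bullet> \<sigma> m = c (\<sigma> m)" for m
    unfolding eq by (rule basis_inner_sum[OF \<sigma>])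
  then show ?thesis
    by (simp only:) (rule eq)
qed

lemma coords_eq_inner:
  assumes \<sigma>: "orthonormal_basis_u \<sigma>" and X: "skew_hermitian X"
  shows "coords \<sigma> X = (\<chi> n. X \<bullet> \<sigma> n)"
  unfolding coords_def
proof (rule the_equality)
  show "X = (\<Sum>n\<in>UNIV. (\<chi> n. X \<bullet> \<sigma> n) $ n *\<^sub>R \<sigma> n)"
    unfolding vec_lambda_beta by (rule skew_hermitian_expansion[OF assms])
  show "c = (\<chi> n. X \<bullet> \<sigma> n)" if "X = (\<Sum>n\<in>UNIV. c $ n *\<^sub>R \<sigma> n)" for c
    unfolding that by (simp add: basis_inner_sum[OF \<sigma>] vec_eq_iff)
qed

text \<open>Parseval's identity, which makes a bound on the Frobenius norm of \<open>dGamma\<close>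
  a bound on its coordinate vector.\<close>

lemma norm_coords:
  assumes \<sigma>: "orthonormal_basis_u \<sigma>" and X: "skew_hermitian X"
  shows "norm (coords \<sigma> X) = norm X"
proof -
  have "X \<bullet> X = (\<Sum>n\<in>UNIV. (X \<bullet> \<sigma> n) *\<^sub>R \<sigma> n) \<bullet> X"
    by (simp only: skew_hermitian_expansion[OF assms, symmetric])
  also have "\<dots> = (\<Sum>n\<in>UNIV. (X \<bullet> \<sigma> n) * (X \<bullet> \<sigma> n))"
    by (simp add: inner_sum_left inner_commute[of "\<sigma> _" X])
  also have "\<dots> = coords \<sigma> X \<bullet> coords \<sigma> X"
    by (simp add: coords_eq_inner[OF assms] inner_vec_def[of "vec_lambda _"])
  finally show ?thesis by (simp add: norm_eq_sqrt_inner)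
qed

section \<open>The matrices D and the row vectors z as trace pairings\<close>

lemma linear_trace: "linear (trace :: 'n::finite cmat \<Rightarrow> complex)"
  by (rule linearI) (simp_all add: trace_def sum.distrib scaleR_sum_right)

lemma bounded_linear_trace: "bounded_linear (trace :: 'n::finite cmat \<Rightarrow> complex)"
  using linear_trace by (simp add: linear_conv_bounded_linear)

text \<open>The trace pairing is bounded and linear, hence moves out of the integral. This exhibits
  \<open>Dmat\<close> as the matrix of \<open>duhamel\<close> in the basis.\<close>

lemma Dmat_entry: "Dmat \<sigma> A h k $ m $ n = duhamel (Gamma A h k) (\<sigma> n) \<bullet> \<sigma> m"
proof -
  let ?f = "\<lambda>s. mexp ((- s) *\<^sub>R Gamma A h k) ** \<sigma> n ** mexp (s *\<^sub>R Gamma A h k)"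
  let ?T = "\<lambda>Z. trace (Z ** cadj (\<sigma> m))"
  have int: "?f integrable_on {0..1}"
    by (rule integrable_continuous_real[OF continuous_on_conjugate])
  have lin: "bounded_linear ?T"
    by (rule bounded_linear_compose[OF bounded_linear_trace mm.bounded_linear_left])
  have "integral {0..1} (?T \<circ> ?f) = ?T (integral {0..1} ?f)"
    by (rule integral_linear[OF int lin])
  then show ?thesis
    by (simp add: Dmat_def duhamel_def inner_cmat o_def)
qed

text \<open>The coordinates are removed by collapsing first the expansion of \<open>G\<close> inside
  \<open>duhamel\<close>, then that of its image. The second expansion is legitimate because
  \<open>duhamel\<close> preserves skew-Hermitian matrices; the matrix built from
  \<open>Pmat\<close> is never expanded.\<close>

lemma zvec_inner_coords:
  assumes \<sigma>: "orthonormal_basis_u \<sigma>" and \<Gamma>: "skew_hermitian (Gamma A h k)" and G: "skew_hermitian G"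
  shows "zvec \<sigma> \<alpha> A h \<tau> k \<bullet> coords \<sigma> G
    = cscale (zstar \<alpha> (propagator A h \<tau> 0)) (Pmat \<alpha> A h \<tau> k) \<bullet> duhamel (Gamma A h k) G"
proof -
  let ?Q = "cscale (zstar \<alpha> (propagator A h \<tau> 0)) (Pmat \<alpha> A h \<tau> k)"
  let ?D = "duhamel (Gamma A h k)"
  have "zvec \<sigma> \<alpha> A h \<tau> k \<bullet> coords \<sigma> G = (\<Sum>n\<in>UNIV. \<Sum>m\<in>UNIV. (?Q \<bullet> \<sigma> m) * (?D (\<sigma> n) \<bullet> \<sigma> m) * (G \<bullet> \<sigma> n))"
    by (simp add: zvec_def vector_matrix_mult_def inner_vec_def[where 'b = 'a] pvec_def Dmat_entry
        coords_eq_inner[OF \<sigma> G] inner_cmat[symmetric] sum_distrib_left sum_distrib_right mult_ac)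
  also have "\<dots> = (\<Sum>m\<in>UNIV. (?Q \<bullet> \<sigma> m) * ((\<Sum>n\<in>UNIV. (G \<bullet> \<sigma> n) *\<^sub>R ?D (\<sigma> n)) \<bullet> \<sigma> m))"
    by (subst sum.swap) (simp add: inner_sum_left sum_distrib_left mult_ac)
  also have "(\<Sum>n\<in>UNIV. (G \<bullet> \<sigma> n) *\<^sub>R ?D (\<sigma> n)) = ?D (\<Sum>n\<in>UNIV. (G \<bullet> \<sigma> n) *\<^sub>R \<sigma> n)"
    by (simp add: linear_sum[OF linear_duhamel] linear_cmul[OF linear_duhamel])
  also have "\<dots> = ?D G"
    by (simp flip: skew_hermitian_expansion[OF \<sigma> G])
  also have "(\<Sum>m\<in>UNIV. (?Q \<bullet> \<sigma> m) * (?D G \<bullet> \<sigma> m)) = ?Q \<bullet> (\<Sum>m\<in>UNIV. (?D G \<bullet> \<sigma> m) *\<^sub>R \<sigma> m)"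
    by (simp add: inner_sum_right mult.commute)
  also have "\<dots> = ?Q \<bullet> ?D G"
    by (simp flip: skew_hermitian_expansion[OF \<sigma> skew_hermitian_duhamel[OF \<Gamma> G]])
  finally show ?thesis .
qed

section \<open>Sensitivity of the propagator and of the fidelity\<close>

lemma mexp_compose_has_vector_derivative:
  assumes "(f has_vector_derivative f') (at x)"
  shows "((\<lambda>t. mexp (f t)) has_vector_derivative mexp (f x) ** duhamel (f x) f') (at x)"
  using has_derivative_compose[OF assms[unfolded has_vector_derivative_def] mexp_has_derivative]
  by (simp add: has_vector_derivative_def linear_cmul[OF linear_duhamel] mm.scaleR_right)

section \<open>Product rule for the propagator\<close>

lemma propagator_refl [simp]: "propagator A h i i = mat 1"
  by (simp add: propagator_def)

lemma propagator_Suc: "i \<le> j \<Longrightarrow> propagator A h (Suc j) i = mexp (Gamma A h (Suc j)) ** propagator A h j i"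
  by (simp add: propagator_def Suc_diff_le)

text \<open>The derivative of the \<open>k\<close>-th factor is that factor times a
  \<open>duhamel\<close> term. The factor is absorbed into the propagator on its left, which
  therefore starts at \<open>k - 1\<close> rather than \<open>k\<close>.\<close>

lemma propagator_has_vector_derivative:
  assumes "\<And>k. k \<in> {1..\<tau>} \<Longrightarrow> ((\<lambda>\<delta>. Gamma (At \<delta>) h k) has_vector_derivative G k) (at x)"
  shows "((\<lambda>\<delta>. propagator (At \<delta>) h \<tau> 0) has_vector_derivative
    (\<Sum>k=1..\<tau>. propagator (At x) h \<tau> (k - 1) ** duhamel (Gamma (At x) h k) (G k) ** propagator (At x) h (k - 1) 0)) (at x)"
  using assms
proof (induction \<tau>)
  case (Suc \<tau>)
  let ?E = "mexp (Gamma (At x) h (Suc \<tau>))"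
  let ?W = "\<lambda>k. duhamel (Gamma (At x) h k) (G k)"
  let ?U = "propagator (At x) h"
  have IH: "((\<lambda>\<delta>. propagator (At \<delta>) h \<tau> 0) has_vector_derivative
      (\<Sum>k=1..\<tau>. ?U \<tau> (k - 1) ** ?W k ** ?U (k - 1) 0)) (at x)"
    by (rule Suc.IH) (use Suc.prems in auto)
  have "?E ** (?U \<tau> (k - 1) ** ?W k ** ?U (k - 1) 0) = ?U (Suc \<tau>) (k - 1) ** ?W k ** ?U (k - 1) 0"
    if "k \<in> {1..\<tau>}" for k
    using that by (subst propagator_Suc) (auto simp: matrix_mul_assoc)
  \<comment> \<open>The summand for the new step carries \<open>?U (Suc \<tau>) \<tau>\<close>,
    which is the single factor \<open>?E\<close>.\<close>
  then have "?E ** (\<Sum>k=1..\<tau>. ?U \<tau> (k - 1) ** ?W k ** ?U (k - 1) 0) + ?E ** ?W (Suc \<tau>) ** ?U \<tau> 0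
      = (\<Sum>k=1..Suc \<tau>. ?U (Suc \<tau>) (k - 1) ** ?W k ** ?U (k - 1) 0)"
    by (simp add: mm.sum_right propagator_Suc)
  then show ?case
    using mm.has_vector_derivative[OF mexp_compose_has_vector_derivative[OF Suc.prems[of "Suc \<tau>"]] IH]
    by (simp only: propagator_Suc[OF le0]) simp
qed simp

text \<open>The commutator makes \<open>Gamma\<close> quadratic in \<open>\<delta>\<close>; at 0 the
  quadratic term drops out and the two mixed commutators remain. The explicit form later shows that
  \<open>dGamma\<close> is skew-Hermitian.\<close>

lemma Gamma_has_vector_derivative:
  fixes X Y :: "real \<Rightarrow> 'n::finite cmat" and h :: real
  defines "G \<equiv> \<lambda>k. (h / 6) *\<^sub>R (Y ((real k - 1) * h) + 4 *\<^sub>R Y (real k * h - h / 2) + Y (real k * h))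
    - (h\<^sup>2 / 12) *\<^sub>R (commutator (X ((real k - 1) * h)) (Y (real k * h)) + commutator (Y ((real k - 1) * h)) (X (real k * h)))"
  shows "((\<lambda>\<delta>. Gamma (\<lambda>t. X t + \<delta> *\<^sub>R Y t) h k) has_vector_derivative G k) (at 0)"
proof -
  have affine: "((\<lambda>\<delta>. X t + \<delta> *\<^sub>R Y t) has_vector_derivative Y t) (at 0)" for t
    by (auto intro!: derivative_eq_intros)
  have "((\<lambda>\<delta>. commutator (X s + \<delta> *\<^sub>R Y s) (X t + \<delta> *\<^sub>R Y t)) has_vector_derivative
      commutator (X s) (Y t) + commutator (Y s) (X t)) (at 0)" for s t
    unfolding commutator_def
    using has_vector_derivative_diff[OF mm.has_vector_derivative[OF affine[of s] affine[of t]]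
        mm.has_vector_derivative[OF affine[of t] affine[of s]]]
    by (simp add: algebra_simps)
  then show ?thesis
    unfolding Gamma_def G_def
    by (intro has_vector_derivative_diff has_vector_derivative_add affine
        bounded_linear.has_vector_derivative[OF bounded_linear_scaleR_right])
qed

lemma skew_hermitian_Gamma:
  "(\<And>t. skew_hermitian (A t)) \<Longrightarrow> skew_hermitian (Gamma A h k)"
  unfolding Gamma_def by (intro skew_hermitian_intros)

text \<open>Both kinds of perturbation are affine in \<open>\<delta>\<close>, so they can be
  differentiated together.\<close>

lemma perturbed_generator_eq:
  assumes "\<mu> \<le> M"
  shows "perturbed_generator B C M u \<mu> S \<delta> t
    = generator B C M u t + \<delta> *\<^sub>R (if \<mu> = 0 then S else u \<mu> t *\<^sub>R S)"
proof (cases "\<mu> = 0")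
  case False
  \<comment> \<open>The perturbation becomes a summand supported at \<open>m = \<mu>\<close>, an
    index of the sum because \<open>1 \<le> \<mu> \<le> M\<close>.\<close>
  have "u m t *\<^sub>R (C(\<mu> := C \<mu> + \<delta> *\<^sub>R S)) m = u m t *\<^sub>R C m + (if m = \<mu> then \<delta> *\<^sub>R u \<mu> t *\<^sub>R S else 0)" for m
    by (simp add: scaleR_add_right)
  with False assms show ?thesis
    by (simp add: perturbed_generator_def generator_def sum.distrib del: fun_upd_apply)
qed (simp add: perturbed_generator_def generator_def)

text \<open>Both fidelities depend on \<open>V\<close> only through the modulus of the trace of \<open>observable \<alpha> ** V\<close>.\<close>

fun observable :: "'n::finite objective \<Rightarrow> 'n cmat" where
  "observable (State_Transfer \<psi>0 \<psi>f) = ketbra \<psi>0 \<psi>f"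
| "observable (Gate Uf) = cadj Uf"

text \<open>Brings the transition amplitude into the trace form shared with the gate case.\<close>

lemma trace_ketbra: "trace (ketbra \<phi> \<psi> ** V) = braket \<psi> (V *v \<phi>)"
proof -
  have "trace (ketbra \<phi> \<psi> ** V) = (\<Sum>i\<in>UNIV. \<Sum>j\<in>UNIV. \<phi> $ i * cnj (\<psi> $ j) * V $ j $ i)"
    by (simp add: trace_def matrix_matrix_mult_def ketbra_def)
  also have "\<dots> = braket \<psi> (V *v \<phi>)"
    by (subst sum.swap) (simp add: braket_def matrix_vector_mult_def sum_distrib_left mult_ac)
  finally show ?thesis .
qed

lemma trace_cadj: "trace (cadj X) = cnj (trace X)"
  by (simp add: trace_def cadj_def)

text \<open>The adjoint of a rank-one \<open>ketbra\<close> swaps its two vectors; cyclicity of the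
  trace does the rest.\<close>

lemma braket_cadj: "braket \<phi> (cadj V *v \<psi>) = cnj (braket \<psi> (V *v \<phi>))"
proof -
  have "cadj (ketbra \<phi> \<psi>) = ketbra \<psi> \<phi>"
    by (simp add: cadj_def ketbra_def vec_eq_iff mult.commute)
  then have "cnj (braket \<psi> (V *v \<phi>)) = trace (cadj V ** ketbra \<psi> \<phi>)"
    by (simp only: trace_ketbra[symmetric] trace_cadj[symmetric] cadj_mult)
  then show ?thesis
    by (simp only: trace_mul_sym[of "cadj V"] trace_ketbra)
qed

text \<open>This is how \<open>zstar\<close> enters the sensitivity: differentiating the modulus of
  the amplitude produces exactly this conjugate as a factor.\<close>

lemma zstar_eq: "zstar \<alpha> V = cnj (trace (observable \<alpha> ** V))"
proof (cases \<alpha>)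
  case (Gate Uf)
  have "cadj V ** Uf = cadj (cadj Uf ** V)" by (simp add: cadj_mult)
  with Gate show ?thesis by (simp only: zstar.simps observable.simps trace_cadj)
qed (simp add: braket_cadj trace_ketbra)

lemma Pmat_eq: "Pmat \<alpha> A h \<tau> k = propagator A h (k - 1) 0 ** observable \<alpha> ** propagator A h \<tau> (k - 1)"
  by (cases \<alpha>) simp_all

lemma trace_cscale: "trace (cscale c X) = c * trace X"
  by (simp add: trace_def cscale_def sum_distrib_left)

lemma cscale_mult: "cscale c X ** Y = cscale c (X ** Y)"
  by (simp add: cscale_def matrix_matrix_mult_def vec_eq_iff sum_distrib_left mult.assoc)

lemma cmod_sq_has_real_derivative:
  fixes f :: "real \<Rightarrow> complex"
  assumes f: "(f has_vector_derivative f') (at x)"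
  shows "((\<lambda>t. (cmod (f t))\<^sup>2) has_real_derivative 2 * Re (cnj (f x) * f')) (at x)"
proof -
  have "((\<lambda>t. f t \<bullet> f t) has_vector_derivative f x \<bullet> f' + f' \<bullet> f x) (at x)"
    by (rule bounded_bilinear.has_vector_derivative[OF bounded_bilinear_inner f f])
  moreover have "f x \<bullet> f' + f' \<bullet> f x = 2 * Re (cnj (f x) * f')"
    by (simp add: inner_complex_def)
  ultimately show ?thesis
    by (simp only: has_real_derivative_iff_has_vector_derivative power2_norm_eq_inner)
qed

text \<open>Differentiates the square root of the squared modulus, away from its singularity at
  0.\<close>

lemma cmod_has_real_derivative:
  fixes f :: "real \<Rightarrow> complex"
  assumes f: "(f has_vector_derivative f') (at x)" and nz: "f x \<noteq> 0"
  shows "((\<lambda>t. cmod (f t)) has_real_derivative Re (cnj (f x) * f') / cmod (f x)) (at x)"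
proof -
  have "((\<lambda>t. sqrt ((cmod (f t))\<^sup>2)) has_real_derivative
      inverse (sqrt ((cmod (f x))\<^sup>2)) / 2 * (2 * Re (cnj (f x) * f'))) (at x)"
    by (rule DERIV_chain2[OF DERIV_real_sqrt cmod_sq_has_real_derivative[OF f]]) (simp add: nz)
  moreover have "inverse a / 2 * (2 * r) = r / a" for a r :: real
    by (cases "a = 0") (simp_all add: field_simps)
  ultimately show ?thesis
    by (simp only: real_sqrt_abs abs_norm_cancel)
qed

text \<open>For states the factor 2 comes from the square. For gates the factor is 1 over N times
  the modulus of the trace; that modulus is N times the fidelity, and positive fidelity keeps it
  away from 0.\<close>

lemma fidelity_has_real_derivative:
  assumes adm: "admissible \<alpha> (V x)"
    and w: "((\<lambda>t. trace (observable \<alpha> ** V t)) has_vector_derivative w') (at x)"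
  shows "((\<lambda>t. fidelity \<alpha> (V t)) has_real_derivative
    gamma_factor \<alpha> (V x) * Re (zstar \<alpha> (V x) * w')) (at x)"
proof (cases \<alpha>)
  case (State_Transfer \<psi>0 \<psi>f)
  then show ?thesis
    using cmod_sq_has_real_derivative[OF w] by (simp add: zstar_eq[of "\<alpha>"] trace_ketbra braket_cadj)
next
  case (Gate Uf)
  with adm have nz: "trace (observable \<alpha> ** V x) \<noteq> 0"
    by auto
  have "((\<lambda>t. cmod (trace (observable \<alpha> ** V t)) / real CARD('n)) has_real_derivative
      Re (cnj (trace (observable \<alpha> ** V x)) * w') / cmod (trace (observable \<alpha> ** V x)) / real CARD('n)) (at x)"
    by (rule DERIV_cdivide[OF cmod_has_real_derivative[OF w nz]])
  moreover have "zstar \<alpha> (V x) = cnj (trace (observable \<alpha> ** V x))"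
    by (rule zstar_eq)
  ultimately show ?thesis
    using Gate by (simp add: power2_eq_square field_simps)
qed

theorem theorem2:
  fixes B S :: "'n::finite cmat"
    and C :: "nat \<Rightarrow> 'n cmat"
    and u :: "nat \<Rightarrow> real \<Rightarrow> real"
    and M \<tau> \<mu> :: nat
    and h b :: real
    and A :: "real \<Rightarrow> 'n cmat"
    and At :: "real \<Rightarrow> real \<Rightarrow> 'n cmat"
    and \<sigma> :: "'d::finite \<Rightarrow> 'n cmat"
    and \<alpha> :: "'n objective"
  assumes h_pos: "h > 0"
    and B_skew: "skew_hermitian B"
    and C_skew: "\<And>m. m \<in> {1..M} \<Longrightarrow> skew_hermitian (C m)"
    and u_cont: "\<And>m. m \<in> {1..M} \<Longrightarrow> continuous_on {0..real \<tau> * h} (u m)"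
    and A_eq: "A = generator B C M u"
    and step_size: "\<And>s. 0 \<le> s \<Longrightarrow> s \<le> real \<tau> * h - h \<Longrightarrow>
                      integral {s..s + h} (\<lambda>t. spectral_norm (A t)) < pi"
    and mu_range: "\<mu> \<le> M"
    and S_skew: "skew_hermitian S"
    and At_eq: "At = perturbed_generator B C M u \<mu> S"
    and basis_card: "CARD('d) = CARD('n)\<^sup>2"
    and basis: "orthonormal_basis_u \<sigma>"
    and admissible: "admissible \<alpha> (propagator A h \<tau> 0)"
    and b_nonneg: "b \<ge> 0"
    and b_bound: "\<And>k. k \<in> {1..\<tau>} \<Longrightarrow> frob_norm (dGamma At h k) \<le> b"
  shows "(\<forall>k\<in>{1..\<tau>}. frob_norm (dGamma At h k) = norm (coords \<sigma> (dGamma At h k))) \<and>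
         perturbed_fidelity \<alpha> At h \<tau> differentiable (at 0) \<and>
         \<bar>deriv (perturbed_fidelity \<alpha> At h \<tau>) 0\<bar>
           \<le> gamma_factor \<alpha> (propagator A h \<tau> 0) * (\<Sum>k=1..\<tau>. \<bar>Zcomp \<sigma> \<alpha> A h \<tau> k\<bar>) * b"
proof (intro conjI ballI)
  let ?U = "propagator A h"
  let ?w = "\<lambda>\<delta>. trace (observable \<alpha> ** propagator (At \<delta>) h \<tau> 0)"
  let ?W = "\<lambda>k. duhamel (Gamma A h k) (dGamma At h k)"
  let ?Q = "\<lambda>k. cscale (zstar \<alpha> (?U \<tau> 0)) (Pmat \<alpha> A h \<tau> k)"
  define Y where "Y t = (if \<mu> = 0 then S else u \<mu> t *\<^sub>R S)" for t
  have At: "At = (\<lambda>\<delta> t. A t + \<delta> *\<^sub>R Y t)"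
    by (simp add: fun_eq_iff At_eq A_eq Y_def perturbed_generator_eq[OF mu_range])
  have At0: "At 0 = A"
    by (simp add: At)
  have A_skew: "skew_hermitian (A t)" for t
    unfolding A_eq generator_def by (intro skew_hermitian_intros B_skew C_skew)
  have Y_skew: "skew_hermitian (Y t)" for t
    using S_skew by (simp add: Y_def skew_hermitian_scaleR)
  have Gamma_skew: "skew_hermitian (Gamma A h k)" for k
    by (rule skew_hermitian_Gamma[OF A_skew])
  have Gamma_deriv: "((\<lambda>\<delta>. Gamma (At \<delta>) h k) has_vector_derivative dGamma At h k) (at 0)" for k
    unfolding dGamma_def At using Gamma_has_vector_derivative[of A Y h k]
    by (simp add: vector_derivative_at)
  \<comment> \<open>The explicit derivative is a real combination of skew-Hermitian matrices and
    their commutators, so its expansion in the basis is available.\<close>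
  have dGamma_skew: "skew_hermitian (dGamma At h k)" for k
    unfolding dGamma_def At vector_derivative_at[OF Gamma_has_vector_derivative]
    by (intro skew_hermitian_intros A_skew Y_skew)
  show "frob_norm (dGamma At h k) = norm (coords \<sigma> (dGamma At h k))" for k
    by (rule norm_coords[OF basis dGamma_skew, symmetric])

  define w' where "w' = (\<Sum>k=1..\<tau>. trace (observable \<alpha> ** (?U \<tau> (k - 1) ** ?W k ** ?U (k - 1) 0)))"
  have w_deriv: "(?w has_vector_derivative w') (at 0)"
    using bounded_linear.has_vector_derivative[OF
        bounded_linear_compose[OF bounded_linear_trace mm.bounded_linear_right]
        propagator_has_vector_derivative[OF Gamma_deriv], of "observable \<alpha>" \<tau>]
    by (simp add: w'_def At0 mm.sum_right linear_sum[OF linear_trace])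
  \<comment> \<open>The sign arises because the inner product takes the adjoint of its second
    argument, here a skew-Hermitian matrix; it disappears under the absolute value.\<close>
  have term_eq: "Re (zstar \<alpha> (?U \<tau> 0) * trace (observable \<alpha> ** (?U \<tau> (k - 1) ** ?W k ** ?U (k - 1) 0)))
      = - (zvec \<sigma> \<alpha> A h \<tau> k \<bullet> coords \<sigma> (dGamma At h k))" for k
  proof -
    \<comment> \<open>Cyclicity carries the propagator of the earlier steps around to the front,
      which forms \<open>Pmat\<close>.\<close>
    have "trace (observable \<alpha> ** (?U \<tau> (k - 1) ** ?W k ** ?U (k - 1) 0)) = trace (Pmat \<alpha> A h \<tau> k ** ?W k)"
      unfolding Pmat_eq matrix_mul_assoc[symmetric]
      by (subst (2) trace_mul_sym) (simp only: matrix_mul_assoc)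
    moreover have "cadj (?W k) = - ?W k"
      using skew_hermitian_duhamel[OF Gamma_skew dGamma_skew] by (simp add: skew_hermitian_def)
    ultimately show ?thesis
      by (simp add: zvec_inner_coords[OF basis Gamma_skew dGamma_skew] inner_cmat mm.minus_right
          linear_neg[OF linear_trace] cscale_mult trace_cscale)
  qed
  have "\<bar>Re (zstar \<alpha> (?U \<tau> 0) * w')\<bar> \<le> (\<Sum>k=1..\<tau>. \<bar>zvec \<sigma> \<alpha> A h \<tau> k \<bullet> coords \<sigma> (dGamma At h k)\<bar>)"
    unfolding w'_def sum_distrib_left Re_sum term_eq sum_negf abs_minus_cancel by (rule sum_abs)
  also have "\<dots> \<le> (\<Sum>k=1..\<tau>. \<bar>Zcomp \<sigma> \<alpha> A h \<tau> k\<bar> * b)"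
  proof (rule sum_mono)
    fix k assume k: "k \<in> {1..\<tau>}"
    have "\<bar>zvec \<sigma> \<alpha> A h \<tau> k \<bullet> coords \<sigma> (dGamma At h k)\<bar>
        \<le> norm (zvec \<sigma> \<alpha> A h \<tau> k) * norm (coords \<sigma> (dGamma At h k))"
      by (rule Cauchy_Schwarz_ineq2)
    \<comment> \<open>By Parseval the norm of the coordinates is the Frobenius norm, which is at
      most \<open>b\<close>.\<close>
    also have "\<dots> \<le> \<bar>Zcomp \<sigma> \<alpha> A h \<tau> k\<bar> * b"
      using b_bound[OF k] by (simp add: norm_coords[OF basis dGamma_skew] Zcomp_def mult_left_mono)
    finally show "\<bar>zvec \<sigma> \<alpha> A h \<tau> k \<bullet> coords \<sigma> (dGamma At h k)\<bar> \<le> \<bar>Zcomp \<sigma> \<alpha> A h \<tau> k\<bar> * b" .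
  qed
  finally have bound: "\<bar>Re (zstar \<alpha> (?U \<tau> 0) * w')\<bar> \<le> (\<Sum>k=1..\<tau>. \<bar>Zcomp \<sigma> \<alpha> A h \<tau> k\<bar>) * b"
    by (simp add: sum_distrib_right)

  have deriv: "(perturbed_fidelity \<alpha> At h \<tau> has_real_derivative
      gamma_factor \<alpha> (?U \<tau> 0) * Re (zstar \<alpha> (?U \<tau> 0) * w')) (at 0)"
    using fidelity_has_real_derivative[OF _ w_deriv] admissible by (simp add: At0 perturbed_fidelity_def[abs_def])
  then show "perturbed_fidelity \<alpha> At h \<tau> differentiable (at 0)"
    using real_differentiable_def by blast
  have "0 \<le> gamma_factor \<alpha> (?U \<tau> 0)"
    by (cases \<alpha>) simp_all
  then show "\<bar>deriv (perturbed_fidelity \<alpha> At h \<tau>) 0\<bar>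
      \<le> gamma_factor \<alpha> (?U \<tau> 0) * (\<Sum>k=1..\<tau>. \<bar>Zcomp \<sigma> \<alpha> A h \<tau> k\<bar>) * b"
    using bound by (simp add: DERIV_imp_deriv[OF deriv] abs_mult mult.assoc mult_left_mono)
qed

end
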